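(* The solutions of the equation $$(x+y)^{x-y} = y^x$$ in positive integers $x, y$ are exactly the pairs $$x = t(t+1)^{t-1}, \qquad y = (t+1)^{t-1},$$ where $t$ is a positive integer.
   Context: The exponent $x-y$ is an integer that may be zero or negative; powers are understood as rational numbers. *)

theory Defs
  imports Complex_Main
begin

end

(* If x > y, put d = gcd x y, x = d a, y = d b. Cancelling the common factor d of the exponents gives
   (x + y)^(a - b) = y^a with coprime exponents, so x + y = c^a and y = c^(a - b) for some c.
   Then a + b = b c^b, hence b divides a and therefore b = 1, c = a + 1, and t = a. *)
theory Submission
  imports Defs
begin

text \<open>Bezout's \<open>m * u = n * v + 1\<close> turns the equation into
  \<open>(B ^ u) ^ n = (A ^ v) ^ n * A\<close>, so \<open>A\<close> is the \<open>n\<close>-th power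
  of \<open>B ^ u / A ^ v\<close>.\<close>

lemma coprime_exponents_common_base:
  fixes A B m n :: nat
  assumes eq: "A ^ m = B ^ n" and cop: "coprime m n" and pos: "m > 0" "n > 0" "A > 0"
  obtains c where "A = c ^ n" "B = c ^ m"
proof -
  obtain u v where uv: "m * u = n * v + 1"
    using bezout_nat[of m n] pos cop by auto
  have "(B ^ u) ^ n = (A ^ m) ^ u"
    by (simp add: eq mult.commute flip: power_mult)
  also have "\<dots> = A ^ (n * v + 1)"
    by (simp only: uv flip: power_mult)
  also have "\<dots> = (A ^ v) ^ n * A"
    by (simp add: mult.commute flip: power_mult)
  finally have B: "(B ^ u) ^ n = (A ^ v) ^ n * A" .
  \<comment> \<open>Divisibility of \<open>n\<close>-th powers passes to their bases, so the
    quotient \<open>c\<close> is an integer.\<close>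
  then have "A ^ v dvd B ^ u"
    using pos by (metis dvd_triv_left pow_divides_pow_iff)
  then obtain c where "B ^ u = A ^ v * c" ..
  with B pos have A: "A = c ^ n"
    by (simp add: power_mult_distrib)
  then have "B ^ n = (c ^ m) ^ n"
    by (simp add: eq[symmetric] mult.commute flip: power_mult)
  then have "B = c ^ m"
    using pos by (metis power_eq_iff_eq_base zero_le)
  with A that show thesis by blast
qed

lemma power_diff_eq_power_parametrization:
  fixes x y :: nat
  assumes "0 < y" "y < x" and eq: "(x + y) ^ (x - y) = y ^ x"
  obtains t where "t > 0" "x = t * (t + 1) ^ (t - 1)" "y = (t + 1) ^ (t - 1)"
proof -
  define d where "d = gcd x y"
  have d: "d > 0" using assms by (simp add: d_def)
  obtain a b where ab: "x = d * a" "y = d * b" "coprime a b"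
    using gcd_coprime_exists[of x y] d unfolding d_def by (metis mult.commute neq0_conv)
  have b: "0 < b" "b < a" using assms ab by auto
  have "((x + y) ^ (a - b)) ^ d = (y ^ a) ^ d"
    using eq unfolding ab by (simp add: diff_mult_distrib2 mult.commute flip: power_mult)
  then have "(x + y) ^ (a - b) = y ^ a"
    using d by (metis power_eq_iff_eq_base zero_le)
  \<comment> \<open>Euclid's subtraction step, used twice: gcd(a-b, a) = gcd(a-b, b) = gcd(a,
    b).\<close>
  moreover have "coprime (a - b) a"
    using ab(3) b gcd_add2[of "a - b" b] gcd_diff1_nat[of b a]
    by (simp add: coprime_iff_gcd_eq_1)
  ultimately obtain c where c: "x + y = c ^ a" "y = c ^ (a - b)"
    using b assms(1) coprime_exponents_common_base[of "x + y" "a - b" y a] by auto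
  \<comment> \<open>This splits off the factor \<open>y\<close>: \<open>x + y = y * c ^ b\<close>,
    where \<open>d\<close> cancels.\<close>
  have "c ^ a = c ^ (a - b) * c ^ b"
    using b by (simp flip: power_add)
  then have "d * (a + b) = d * (b * c ^ b)"
    using c ab by (simp add: algebra_simps)
  then have abc: "a + b = b * c ^ b" using d by simp
  then have "b dvd a" by (metis dvd_add_left_iff dvd_refl dvd_triv_left)
  with ab(3) have "b = 1" by (metis coprime_common_divisor_nat dvd_refl)
  with abc have "c = a + 1" by simp
  with c ab \<open>b = 1\<close> b have "y = (a + 1) ^ (a - 1)" "x = a * y" by simp_all
  with that[of a] b show thesis by simp
qed

text \<open>For \<open>x < y\<close> the left side would be the reciprocal of an integer above 1,
  but the right side is a positive integer. Negative exponents are thus excluded.\<close>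

lemma powi_diff_eq_power_imp_le:
  fixes x y :: nat
  assumes "0 < x" "0 < y"
    and eq: "(rat_of_nat x + rat_of_nat y) powi (int x - int y) = rat_of_nat y ^ x"
  shows "y \<le> x"
proof (rule ccontr)
  assume "\<not> y \<le> x"
  then have e: "int x - int y = - int (y - x)" "y - x > 0" by simp_all
  have s: "rat_of_nat x + rat_of_nat y = rat_of_nat (x + y)" by simp
  have "inverse (rat_of_nat ((x + y) ^ (y - x))) = rat_of_nat (y ^ x)"
    using eq unfolding e s by (simp only: power_int_minus power_int_of_nat of_nat_power)
  then have "rat_of_nat (y ^ x * (x + y) ^ (y - x)) = 1"
    using assms(1) by (simp add: field_simps)
  then have "y ^ x * (x + y) ^ (y - x) = 1" by (simp only: of_nat_eq_1_iff)
  then have "(x + y) ^ (y - x) = 1" by simp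
  moreover have "1 < (x + y) ^ (y - x)"
    using assms e(2) by (intro one_less_power) simp_all
  ultimately show False by (metis less_irrefl)
qed

theorem mainTheorem13:
  "{(x :: nat, y :: nat). x > 0 \<and> y > 0 \<and>
      (rat_of_nat x + rat_of_nat y) powi (int x - int y) = rat_of_nat y ^ x}
   = {(t * (t + 1) ^ (t - 1), (t + 1) ^ (t - 1)) | t :: nat. t > 0}"
proof -
  \<comment> \<open>When \<open>y \<le> x\<close>, truncated subtraction agrees with the integer
    difference, so the equation can be read in the naturals.\<close>
  have nat_eq: "(rat_of_nat x + rat_of_nat y) powi (int x - int y) = rat_of_nat y ^ x \<longleftrightarrow>
      (x + y) ^ (x - y) = y ^ x" if "y \<le> x" for x y :: nat
  proof -
    have e: "int x - int y = int (x - y)" using that by simp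
    have "rat_of_nat x + rat_of_nat y = rat_of_nat (x + y)" by simp
    then show ?thesis
      unfolding e by (simp only: power_int_of_nat of_nat_eq_iff flip: of_nat_power)
  qed
  have "x > 0 \<and> y > 0 \<and>
      (rat_of_nat x + rat_of_nat y) powi (int x - int y) = rat_of_nat y ^ x \<longleftrightarrow>
      (\<exists>t>0. x = t * (t + 1) ^ (t - 1) \<and> y = (t + 1) ^ (t - 1))" (is "?L \<longleftrightarrow> ?R") for x y :: nat
  proof
    assume L: ?L
    then have le: "y \<le> x" using powi_diff_eq_power_imp_le by blast
    with L have eq: "(x + y) ^ (x - y) = y ^ x" using nat_eq by blast
    show ?R
    proof (cases "x = y")
      \<comment> \<open>Exponent 0 makes the left side 1, which leaves only the pair (1, 1), given
        by \<open>t = 1\<close>.\<close>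
      case True
      with eq have "y ^ y = 1" by simp
      with L True have "y = 1" by simp
      with True show ?thesis by (intro exI[of _ 1]) simp
    next
      case False
      with le L eq show ?thesis
        using power_diff_eq_power_parametrization[of y x] by (metis le_neq_implies_less)
    qed
  next
    assume ?R
    then obtain t where t: "t > 0" "y = (t + 1) ^ (t - 1)" "x = t * y" by blast
    \<comment> \<open>Both sides become powers of \<open>t + 1\<close>, with exponents
      \<open>t * (x - y)\<close> and \<open>(t - 1) * x\<close>; these agree because
      \<open>x = t * y\<close>.\<close>
    have "x + y = (t + 1) ^ t"
      using t by (cases t) (simp_all add: algebra_simps)
    moreover have "t * (x - y) = (t - 1) * x"
      using t(3) by (simp add: algebra_simps)
    ultimately have "(x + y) ^ (x - y) = y ^ x"
      by (simp add: t(2) flip: power_mult)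
    moreover have "y > 0" "y \<le> x" using t by simp_all
    ultimately show ?L using nat_eq by auto
  qed
  then show ?thesis by auto
qed

end
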